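(* Let $G$ be an SPN graph. Then $G$ does not contain any of the following as a subgraph: (1) a subdivision of the fan $F_5$; (2) a subdivision of $CD_6$; (3) a subdivision of $K_4$ in which at least two edges and at most five edges were subdivided, each at least once.
   Context: All graphs are finite and simple. A real symmetric matrix $A$ is copositive if $x^TAx\ge 0$ for every entrywise nonnegative vector $x$. A real symmetric matrix is SPN if it is the sum of a real positive semidefinite matrix and a symmetric entrywise nonnegative matrix. The graph $G(A)$ of a real symmetric $n\times n$ matrix $A$ has vertices $\{1,\dots,n\}$, and $ij$ ($i\ne j$) is an edge if and only if $a_{ij}\neq 0$. A graph $G$ is an SPN graph if every copositive matrix whose graph is $G$ is SPN (this does not depend on the labelling of the vertices). Subgraphs are not necessarily induced. $F_5$ is the graph on $5$ vertices consisting of a path on $4$ vertices (length $3$) and an additional vertex adjacent to all four vertices of the path. $CD_6$ is the graph on vertices $1,\dots,6$ with edges $12,13,23,34,25,45,46,56$. A subdivision of a graph $H$ is a graph obtained from $H$ by replacing edges of $H$ by paths with the same ends whose inner vertices are new and of degree $2$; an edge is subdivided $k$ times if it is replaced by a path of length $k+1$. Any graph is considered to be a subdivision of itself. *)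

theory Defs
  imports "HOL-Analysis.Analysis"
begin

section \<open>Graphs, subgraphs and subdivisions\<close>

datatype 'a graph = Graph (verts: "'a set") (edges: "'a set set")

definition simple_graph :: "'a graph \<Rightarrow> bool" where
  "simple_graph G \<longleftrightarrow> finite (verts G) \<and> (\<forall>e\<in>edges G. e \<subseteq> verts G \<and> card e = 2)"

definition subgraph :: "'a graph \<Rightarrow> 'a graph \<Rightarrow> bool" where
  "subgraph S G \<longleftrightarrow> simple_graph S \<and> verts S \<subseteq> verts G \<and> edges S \<subseteq> edges G"

definition path_edges :: "'a list \<Rightarrow> 'a set set" where
  "path_edges p = {{p ! i, p ! Suc i} | i. Suc i < length p}"

definition inner_verts :: "'a list \<Rightarrow> 'a set" where
  "inner_verts p = set (butlast (tl p))"

text \<open>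
  \<open>subdivision_by H k S\<close>: up to the names of its vertices, \<open>S\<close> is the subdivision of \<open>H\<close> in
  which every edge \<open>e\<close> is subdivided \<open>k e\<close> times. The map \<open>f\<close> names the vertices of \<open>H\<close> in \<open>S\<close>,
  and \<open>p e\<close> lists the vertices of the path replacing \<open>e\<close> (in either direction). Since inner
  vertices lie on only one path and \<open>S\<close> has no further edges, they have degree 2 in \<open>S\<close>. An edge
  with \<open>k e = 0\<close> is kept.
\<close>

definition subdivision_by :: "'b graph \<Rightarrow> ('b set \<Rightarrow> nat) \<Rightarrow> 'a graph \<Rightarrow> bool" where
  "subdivision_by H k S \<longleftrightarrow>
    (\<exists>f p. inj_on f (verts H) \<and>
      (\<forall>e\<in>edges H. distinct (p e) \<and> length (p e) = k e + 2 \<and>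
         {hd (p e), last (p e)} = f ` e \<and> inner_verts (p e) \<inter> f ` verts H = {}) \<and>
      (\<forall>e\<in>edges H. \<forall>e'\<in>edges H. e \<noteq> e' \<longrightarrow> inner_verts (p e) \<inter> inner_verts (p e') = {}) \<and>
      verts S = f ` verts H \<union> (\<Union>e\<in>edges H. inner_verts (p e)) \<and>
      edges S = (\<Union>e\<in>edges H. path_edges (p e)))"

definition subdivision :: "'b graph \<Rightarrow> 'a graph \<Rightarrow> bool" where
  "subdivision H S \<longleftrightarrow> (\<exists>k. subdivision_by H k S)"

definition F5 :: "nat graph" where
  "F5 = Graph {1..5} {{1,2}, {2,3}, {3,4}, {5,1}, {5,2}, {5,3}, {5,4}}"

definition CD6 :: "nat graph" where
  "CD6 = Graph {1..6} {{1,2}, {1,3}, {2,3}, {3,4}, {2,5}, {4,5}, {4,6}, {5,6}}"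

definition K4 :: "nat graph" where
  "K4 = Graph {1..4} {{i, j} | i j. i \<in> {1..4} \<and> j \<in> {1..4} \<and> i \<noteq> j}"

section \<open>Copositive and SPN matrices\<close>

definition symmetric_matrix :: "real^'n^'n \<Rightarrow> bool" where
  "symmetric_matrix A \<longleftrightarrow> transpose A = A"

definition copositive :: "real^'n^'n \<Rightarrow> bool" where
  "copositive A \<longleftrightarrow> symmetric_matrix A \<and> (\<forall>x. (\<forall>i. 0 \<le> x $ i) \<longrightarrow> 0 \<le> x \<bullet> (A *v x))"

definition positive_semidefinite :: "real^'n^'n \<Rightarrow> bool" where
  "positive_semidefinite A \<longleftrightarrow> symmetric_matrix A \<and> (\<forall>x. 0 \<le> x \<bullet> (A *v x))"

definition nonnegative_matrix :: "real^'n^'n \<Rightarrow> bool" where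
  "nonnegative_matrix A \<longleftrightarrow> (\<forall>i j. 0 \<le> A $ i $ j)"

definition spn_matrix :: "real^'n^'n \<Rightarrow> bool" where
  "spn_matrix A \<longleftrightarrow>
    (\<exists>P N. positive_semidefinite P \<and> symmetric_matrix N \<and> nonnegative_matrix N \<and> A = P + N)"

definition matrix_graph :: "real^'n^'n \<Rightarrow> 'n graph" where
  "matrix_graph A = Graph UNIV {{i, j} | i j. i \<noteq> j \<and> A $ i $ j \<noteq> 0}"

text \<open>
  The finite type \<open>'n\<close> plays the role of the vertex set \<open>{1,\<dots>,n}\<close>: the rows and columns of the
  matrices are indexed by the vertices themselves. The definition is meant for simple graphs
  whose vertex set is the whole type, \<open>verts G = UNIV\<close>; otherwise no matrix has graph \<open>G\<close>.
\<close>

definition spn_graph :: "'n::finite graph \<Rightarrow> bool" where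
  "spn_graph G \<longleftrightarrow> (\<forall>A :: real^'n^'n. copositive A \<and> matrix_graph A = G \<longrightarrow> spn_matrix A)"

end

theory Submission
  imports Defs
begin

text \<open>
  All forbidden subgraphs have the fan \<^const>\<open>F5\<close> as a minor, and no SPN graph has one; the
  theorem combines these two facts.

  A matrix that is SPN pairs nonnegatively with every doubly nonnegative matrix, that is, with
  every entrywise nonnegative \<open>X = \<Sum>\<^sub>k w\<^sub>k w\<^sub>k\<^sup>T\<close>. So a copositive matrix \<open>A\<close> for which the values
  \<open>w\<^sub>k\<^sup>T A w\<^sub>k\<close> have a negative sum is not SPN. As the inequality is strict, it survives a small
  positive entry at every edge where \<open>A\<close> vanishes, so it is enough that the off-diagonal entries
  of \<open>A\<close> are supported on edges of the graph (\<open>spn_graph_form_sum_nonneg\<close>).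

  Such a certificate passes from a minor \<open>H\<close> to the graph \<open>G\<close> in one step
  (\<open>spn_graph_minor_form_sum_nonneg\<close>). Move each coefficient of the form on \<open>H\<close> to an edge of \<open>G\<close>
  between the two branch sets, and add a large multiple of the Laplacian form
  \<open>\<Sum> (x\<^sub>u - x\<^sub>v)\<^sup>2\<close> over the edges inside branch sets and of \<open>x\<^sub>v\<^sup>2\<close> for the discarded vertices.
  Where this penalty vanishes, the new form is the old one; if the old form is strictly
  copositive, compactness gives a multiple for which the new form is copositive. The vectors
  \<open>w\<^sub>k\<close>, extended constantly over branch sets, do not feel the penalty, and their Gram matrix
  stays nonnegative.

  For the fan with path \<open>1, 2, 3, 4\<close> and hub \<open>5\<close> the certificate is explicit. The form
  \<open>(y\<^sub>1 - y\<^sub>2)\<^sup>2 + (y\<^sub>4 - y\<^sub>3)\<^sup>2 + y\<^sub>5\<^sup>2 + 2 y\<^sub>5 (y\<^sub>1 - y\<^sub>2) + 2 y\<^sub>5 (y\<^sub>4 - y\<^sub>3) + 2 y\<^sub>2 y\<^sub>3\<close>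
  is copositive (\<open>fan_form_pos\<close>); it is the Horn form of a 5-cycle with the cross terms at the
  three non-edges removed. Its values at the three rows of \<open>fan_witness\<close>, whose Gram matrix is
  nonnegative, are \<open>-2\<close>, \<open>-2\<close> and \<open>0\<close>. Adding \<open>|y|\<^sup>2 / 100\<close> makes the form strictly copositive and
  raises this sum to \<open>-4 + 94/100\<close> only.

  The minors: \<open>CD6\<close> contracts to the fan along its edge \<open>34\<close>. If two edges of \<open>K4\<close> are
  subdivided, they have distinct ends \<open>s\<close> and \<open>t\<close> such that the first contains \<open>s\<close> but not \<open>t\<close> and
  the second contains \<open>t\<close> but not \<open>s\<close>; contracting the edge between the other two vertices into
  the hub leaves the fan whose path is: inner vertices of the first, \<open>s\<close>, \<open>t\<close>, inner vertices of
  the second.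
\<close>

section \<open>Pairing with doubly nonnegative matrices\<close>

lemma quadratic_form_expand:
  fixes A :: "real^'n^'n"
  shows "x \<bullet> (A *v x) = (\<Sum>i\<in>UNIV. \<Sum>j\<in>UNIV. A $ i $ j * (x $ i * x $ j))"
  by (simp add: inner_vec_def matrix_vector_mult_def sum_distrib_left mult_ac)

text \<open>
  A positive entry on every edge where \<open>A\<close> vanishes turns \<open>A\<close> into a copositive matrix with graph
  \<open>G\<close>. The summands of its SPN decomposition pair nonnegatively with the Gram matrix of the \<open>X k\<close>;
  if \<open>A\<close> itself paired negatively, a small enough entry would not repair this. In this form the
  lemma also covers matrices supported on a proper subgraph of \<open>G\<close>.
\<close>

lemma spn_graph_form_sum_nonneg:
  fixes G :: "'n::finite graph" and A :: "real^'n^'n" and X :: "'i \<Rightarrow> real^'n"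
  assumes G: "simple_graph G" "verts G = UNIV" "spn_graph G"
    and A: "copositive A"
    and support: "\<And>i j. i \<noteq> j \<Longrightarrow> A $ i $ j \<noteq> 0 \<Longrightarrow> {i, j} \<in> edges G"
    and gram: "\<And>i j. 0 \<le> (\<Sum>k\<in>I. X k $ i * X k $ j)"
  shows "0 \<le> (\<Sum>k\<in>I. X k \<bullet> (A *v X k))"
proof (rule ccontr)
  assume neg: "\<not> ?thesis"
  define c where "c = - (\<Sum>k\<in>I. X k \<bullet> (A *v X k))"
  have c: "0 < c" using neg by (simp add: c_def)
  define N :: "real^'n^'n" where
    "N = (\<chi> i j. of_bool (i \<noteq> j \<and> {i, j} \<in> edges G \<and> A $ i $ j = 0))"
  define pair :: "real^'n^'n \<Rightarrow> real" where "pair B = (\<Sum>k\<in>I. X k \<bullet> (B *v X k))" for B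
  have pair_add: "pair (B + C) = pair B + pair C" for B C
    by (simp add: pair_def matrix_vector_mult_add_rdistrib inner_add_right sum.distrib)
  have pair_scale: "pair (e *\<^sub>R B) = e * pair B" for e B
    by (simp add: pair_def scaleR_matrix_vector_assoc[symmetric] sum_distrib_left)
  have pair_nonneg: "0 \<le> pair B" if "\<And>i j. 0 \<le> B $ i $ j" for B
  proof -
    have "pair B = (\<Sum>k\<in>I. \<Sum>i\<in>UNIV. \<Sum>j\<in>UNIV. B $ i $ j * (X k $ i * X k $ j))"
      by (simp add: pair_def quadratic_form_expand)
    also have "\<dots> = (\<Sum>i\<in>UNIV. \<Sum>k\<in>I. \<Sum>j\<in>UNIV. B $ i $ j * (X k $ i * X k $ j))"
      by (rule sum.swap)
    also have "\<dots> = (\<Sum>i\<in>UNIV. \<Sum>j\<in>UNIV. \<Sum>k\<in>I. B $ i $ j * (X k $ i * X k $ j))"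
      by (intro sum.cong refl sum.swap)
    also have "\<dots> = (\<Sum>i\<in>UNIV. \<Sum>j\<in>UNIV. B $ i $ j * (\<Sum>k\<in>I. X k $ i * X k $ j))"
      by (simp add: sum_distrib_left)
    finally show ?thesis using that gram by (simp add: sum_nonneg)
  qed
  have N_nonneg: "0 \<le> N $ i $ j" for i j by (simp add: N_def)
  \<comment> \<open>Chosen so that \<open>e * pair N < c\<close>; the \<open>+ 1\<close> keeps \<open>e\<close> finite and positive if \<open>pair N = 0\<close>.\<close>
  define e where "e = c / (pair N + 1)"
  have pN: "0 \<le> pair N" using N_nonneg by (rule pair_nonneg)
  have e: "0 < e" using c pN by (simp add: e_def)
  define A' where "A' = A + e *\<^sub>R N"
  have symA: "A $ j $ i = A $ i $ j" for i j
    using A by (simp add: copositive_def symmetric_matrix_def transpose_def vec_eq_iff)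
  have "N $ j $ i = N $ i $ j" for i j
    by (auto simp: N_def symA insert_commute)
  then have "symmetric_matrix A'"
    by (simp add: symmetric_matrix_def A'_def transpose_def vec_eq_iff symA)
  moreover have "0 \<le> x \<bullet> (A' *v x)" if "\<forall>i. 0 \<le> x $ i" for x
  proof -
    have "0 \<le> x \<bullet> (A *v x)" using A that by (simp add: copositive_def)
    moreover have "0 \<le> x \<bullet> (N *v x)"
      unfolding quadratic_form_expand using that N_nonneg by (intro sum_nonneg mult_nonneg_nonneg) auto
    ultimately show ?thesis using e
      by (simp add: A'_def matrix_vector_mult_add_rdistrib inner_add_right
          scaleR_matrix_vector_assoc[symmetric])
  qed
  ultimately have cop: "copositive A'" by (simp add: copositive_def)
  have entry: "A' $ i $ j \<noteq> 0 \<longleftrightarrow> {i, j} \<in> edges G" if "i \<noteq> j" for i j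
    using that support[of i j] e by (auto simp: A'_def N_def)
  have "edges G = {{i, j} | i j. i \<noteq> j \<and> A' $ i $ j \<noteq> 0}"
  proof (intro set_eqI iffI)
    fix d assume d: "d \<in> edges G"
    then obtain i j where "d = {i, j}" "i \<noteq> j"
      using G(1) by (auto simp: simple_graph_def card_2_iff)
    then show "d \<in> {{i, j} | i j. i \<noteq> j \<and> A' $ i $ j \<noteq> 0}" using d entry by blast
  qed (use entry in auto)
  then have "matrix_graph A' = G" using G(2) by (cases G) (simp add: matrix_graph_def)
  then obtain P N' where PN: "positive_semidefinite P" "nonnegative_matrix N'" "A' = P + N'"
    using G(3) cop unfolding spn_graph_def spn_matrix_def by blast
  have "0 \<le> pair P" using PN(1) by (simp add: pair_def positive_semidefinite_def sum_nonneg)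
  moreover have "0 \<le> pair N'" using PN(2) by (intro pair_nonneg) (simp add: nonnegative_matrix_def)
  ultimately have "0 \<le> pair A'" by (simp add: PN(3) pair_add)
  moreover have "pair A = - c" by (simp add: c_def pair_def)
  then have "pair A' = - c + e * pair N" by (simp add: A'_def pair_add pair_scale)
  moreover have "e * pair N < c" using c pN by (simp add: e_def field_simps)
  ultimately show False by simp
qed

section \<open>Graph minors\<close>

definition fibre_adj :: "'a graph \<Rightarrow> ('a \<Rightarrow> 'b) \<Rightarrow> 'a \<Rightarrow> 'a \<Rightarrow> bool" where
  "fibre_adj G \<phi> u v \<longleftrightarrow> {u, v} \<in> edges G \<and> \<phi> u = \<phi> v"

text \<open>
  The branch sets of the minor are the fibres of \<open>\<phi>\<close> over the vertices of \<open>H\<close>; vertices of \<open>G\<close>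
  mapped outside \<open>verts H\<close> are deleted.
\<close>

definition minor_model :: "'b graph \<Rightarrow> ('a \<Rightarrow> 'b) \<Rightarrow> 'a graph \<Rightarrow> bool" where
  "minor_model H \<phi> G \<longleftrightarrow>
    verts H \<subseteq> range \<phi> \<and>
    (\<forall>d\<in>edges H. \<exists>u v. {u, v} \<in> edges G \<and> d = {\<phi> u, \<phi> v}) \<and>
    (\<forall>u v. \<phi> u = \<phi> v \<longrightarrow> \<phi> u \<in> verts H \<longrightarrow> (fibre_adj G \<phi>)\<^sup>*\<^sup>* u v)"

definition quad_form :: "'b set \<Rightarrow> ('b \<Rightarrow> 'b \<Rightarrow> real) \<Rightarrow> ('b \<Rightarrow> real) \<Rightarrow> real" where
  "quad_form V a y = (\<Sum>h\<in>V. \<Sum>l\<in>V. a h l * (y h * y l))"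

text \<open>
  Only the compact part of \<open>K\<close> where \<open>q \<le> 0\<close> needs the penalty, and there \<open>p\<close> is bounded away from
  zero.
\<close>

lemma exists_positive_penalty:
  fixes q p :: "'a::t2_space \<Rightarrow> real"
  assumes K: "compact K" and q: "continuous_on K q" and p: "continuous_on K p"
    and p_nonneg: "\<And>x. x \<in> K \<Longrightarrow> 0 \<le> p x"
    and pos: "\<And>x. x \<in> K \<Longrightarrow> p x = 0 \<Longrightarrow> 0 < q x"
  shows "\<exists>M\<ge>0. \<forall>x\<in>K. 0 < q x + M * p x"
proof -
  define C where "C = K \<inter> q -` {..0}"
  have C: "compact C"
    using compact_Int_closed[OF K continuous_closed_preimage[OF q compact_imp_closed[OF K] closed_atMost]]
    by (simp add: C_def)
  show ?thesis
  proof (cases "C = {}")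
    case True
    then show ?thesis by (intro exI[of _ 0]) (auto simp: C_def not_le)
  next
    case False
    have sub: "C \<subseteq> K" by (simp add: C_def)
    obtain z where z: "z \<in> C" "\<And>x. x \<in> C \<Longrightarrow> p z \<le> p x"
      using continuous_attains_inf[OF C False continuous_on_subset[OF p sub]] by blast
    obtain z' where z': "z' \<in> C" "\<And>x. x \<in> C \<Longrightarrow> q z' \<le> q x"
      using continuous_attains_inf[OF C False continuous_on_subset[OF q sub]] by blast
    have zK: "z \<in> K" "\<not> 0 < q z" using z(1) by (auto simp: C_def)
    then have pz: "0 < p z" using p_nonneg[of z] pos[of z] by linarith
    define M where "M = (1 - q z') / p z"
    have "q z' \<le> 0" using z'(1) by (simp add: C_def)
    then have M: "0 \<le> M" "M * p z = 1 - q z'" using pz by (simp_all add: M_def)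
    have "0 < q x + M * p x" if "x \<in> K" for x
    proof (cases "x \<in> C")
      case True
      have "M * p z \<le> M * p x" using z(2)[OF True] M(1) by (rule mult_left_mono)
      then show ?thesis using z'(2)[OF True] M(2) by linarith
    next
      case False
      then have "0 < q x" using that by (auto simp: C_def not_le)
      then show ?thesis using M(1) p_nonneg[OF that] by (simp add: add_pos_nonneg)
    qed
    then show ?thesis using M(1) by blast
  qed
qed

text \<open>
  The transfer of a certificate along a minor. In the proof, \<open>q\<close> is the form on \<open>H\<close> spread over
  representative edges of \<open>G\<close>, \<open>p\<close> is the penalty that forces vectors to be constant on branch
  sets and zero elsewhere, and \<open>A M\<close> is the matrix of \<open>q + M p\<close>. Strict copositivity of the form on
  \<open>H\<close> is what makes a finite \<open>M\<close> suffice.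
\<close>

lemma spn_graph_minor_form_sum_nonneg:
  fixes G :: "'n::finite graph" and H :: "'b graph" and w :: "'i \<Rightarrow> 'b \<Rightarrow> real"
  assumes G: "simple_graph G" "verts G = UNIV" "spn_graph G"
    and model: "minor_model H \<phi> G" and fin: "finite (verts H)"
    and support: "\<And>h l. h \<in> verts H \<Longrightarrow> l \<in> verts H \<Longrightarrow> h \<noteq> l \<Longrightarrow> a h l \<noteq> 0 \<Longrightarrow> {h, l} \<in> edges H"
    and pos: "\<And>y. (\<And>h. h \<in> verts H \<Longrightarrow> 0 \<le> y h) \<Longrightarrow> \<exists>h\<in>verts H. y h \<noteq> 0 \<Longrightarrow> 0 < quad_form (verts H) a y"
    and gram: "\<And>h l. h \<in> verts H \<Longrightarrow> l \<in> verts H \<Longrightarrow> 0 \<le> (\<Sum>i\<in>I. w i h * w i l)"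
  shows "0 \<le> (\<Sum>i\<in>I. quad_form (verts H) a (w i))"
proof -
  let ?V = "verts H"
  have surj: "\<exists>u. \<phi> u = h" if "h \<in> ?V" for h
    using model that unfolding minor_model_def by blast
  have edge: "\<exists>u v. {u, v} \<in> edges G \<and> d = {\<phi> u, \<phi> v}" if "d \<in> edges H" for d
    using model that unfolding minor_model_def by blast
  have conn: "(fibre_adj G \<phi>)\<^sup>*\<^sup>* u v" if "\<phi> u = \<phi> v" "\<phi> u \<in> ?V" for u v
    using model that unfolding minor_model_def by blast
  have "\<exists>u v. \<phi> u = h \<and> \<phi> v = l \<and> (if h = l then u = v else a h l \<noteq> 0 \<longrightarrow> {u, v} \<in> edges G)"
    if hl: "h \<in> ?V" "l \<in> ?V" for h l
  proof -
    obtain u v where uv: "\<phi> u = h" "\<phi> v = l" using surj hl by blast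
    consider "h = l" | "h \<noteq> l" "a h l = 0" | "h \<noteq> l" "a h l \<noteq> 0" by blast
    then show ?thesis
    proof cases
      case 3
      then obtain u' v' where e: "{u', v'} \<in> edges G" "{h, l} = {\<phi> u', \<phi> v'}"
        using edge[OF support[OF hl]] by blast
      show ?thesis
      proof (cases "\<phi> u' = h")
        case True
        then have "\<phi> v' = l" using e(2) by (auto simp: doubleton_eq_iff)
        then show ?thesis using e(1) True 3 by auto
      next
        case False
        then have "\<phi> u' = l" "\<phi> v' = h" using e(2) by (auto simp: doubleton_eq_iff)
        moreover have "{v', u'} \<in> edges G" using e(1) by (simp add: insert_commute)
        ultimately show ?thesis using 3 by auto
      qed
    qed (use uv in auto)
  qed
  then have ex: "\<forall>h l. \<exists>u v. h \<in> ?V \<longrightarrow> l \<in> ?V \<longrightarrow> \<phi> u = h \<and> \<phi> v = l \<and>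
      (if h = l then u = v else a h l \<noteq> 0 \<longrightarrow> {u, v} \<in> edges G)"
    by blast
  have "\<exists>r s. \<forall>h\<in>?V. \<forall>l\<in>?V. \<phi> (r h l) = h \<and> \<phi> (s h l) = l \<and>
      (if h = l then r h l = s h l else a h l \<noteq> 0 \<longrightarrow> {r h l, s h l} \<in> edges G)"
    using ex unfolding choice_iff by blast
  then obtain r s where rs: "\<And>h l. h \<in> ?V \<Longrightarrow> l \<in> ?V \<Longrightarrow> \<phi> (r h l) = h \<and> \<phi> (s h l) = l \<and>
      (if h = l then r h l = s h l else a h l \<noteq> 0 \<longrightarrow> {r h l, s h l} \<in> edges G)"
    by blast
  \<comment> \<open>\<open>B\<close> need not be symmetric, as \<open>r h l\<close> and \<open>s l h\<close> may differ; \<open>A\<close> uses its symmetric part.\<close>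
  define W :: "'n \<Rightarrow> 'n \<Rightarrow> real" where
    "W i j = of_bool ({i, j} \<in> edges G \<and> \<phi> i = \<phi> j \<and> \<phi> i \<in> ?V)" for i j
  have W_sym: "W j i = W i j" for i j by (auto simp: W_def insert_commute)
  define B :: "'n \<Rightarrow> 'n \<Rightarrow> real" where
    "B i j = (\<Sum>h\<in>?V. \<Sum>l\<in>?V. a h l * (of_bool (i = r h l) * of_bool (j = s h l)))" for i j
  define q :: "real^'n \<Rightarrow> real" where
    "q x = (\<Sum>h\<in>?V. \<Sum>l\<in>?V. a h l * (x $ r h l * x $ s h l))" for x
  define p :: "real^'n \<Rightarrow> real" where
    "p x = (\<Sum>i\<in>UNIV. \<Sum>j\<in>UNIV. W i j * (x $ i - x $ j)\<^sup>2)
      + (\<Sum>i\<in>UNIV. of_bool (\<phi> i \<notin> ?V) * (x $ i)\<^sup>2)" for x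
  define D :: "'n \<Rightarrow> 'n \<Rightarrow> real" where
    "D i j = (if i = j then 2 * (\<Sum>k\<in>UNIV. W i k) + of_bool (\<phi> i \<notin> ?V) else 0)" for i j
  define A :: "real \<Rightarrow> real^'n^'n" where
    "A M = (\<chi> i j. (B i j + B j i) / 2 + M * (D i j - 2 * W i j))" for M
  have B_form: "(\<Sum>i\<in>UNIV. \<Sum>j\<in>UNIV. B i j * (x $ i * x $ j)) = q x" for x
  proof -
    have "(\<Sum>i\<in>UNIV. \<Sum>j\<in>UNIV. B i j * (x $ i * x $ j)) =
      (\<Sum>i\<in>UNIV. \<Sum>j\<in>UNIV. \<Sum>h\<in>?V. \<Sum>l\<in>?V.
        a h l * (of_bool (i = r h l) * of_bool (j = s h l)) * (x $ i * x $ j))"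
      by (simp add: B_def sum_distrib_right)
    also have "\<dots> = (\<Sum>h\<in>?V. \<Sum>l\<in>?V. \<Sum>i\<in>UNIV. \<Sum>j\<in>UNIV.
        a h l * (of_bool (i = r h l) * of_bool (j = s h l)) * (x $ i * x $ j))"
      by (simp add: sum.swap[of _ ?V UNIV])
    also have "\<dots> = q x"
      unfolding q_def
    proof (intro sum.cong refl)
      fix h l
      have "(\<Sum>i\<in>UNIV. \<Sum>j\<in>UNIV.
        a h l * (of_bool (i = r h l) * of_bool (j = s h l)) * (x $ i * x $ j)) =
        (\<Sum>i\<in>UNIV. \<Sum>j\<in>UNIV. if j = s h l then (if i = r h l then a h l * (x $ i * x $ j) else 0) else 0)"
        by (intro sum.cong refl) auto
      also have "\<dots> = a h l * (x $ r h l * x $ s h l)" by simp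
      finally show "(\<Sum>i\<in>UNIV. \<Sum>j\<in>UNIV.
        a h l * (of_bool (i = r h l) * of_bool (j = s h l)) * (x $ i * x $ j)) =
        a h l * (x $ r h l * x $ s h l)" .
    qed
    finally show ?thesis .
  qed
  have B_form': "(\<Sum>i\<in>UNIV. \<Sum>j\<in>UNIV. B j i * (x $ i * x $ j)) = q x" for x
    using B_form[of x] by (subst sum.swap) (simp add: mult.commute)
  have D_form: "(\<Sum>i\<in>UNIV. \<Sum>j\<in>UNIV. (D i j - 2 * W i j) * (x $ i * x $ j)) = p x" for x
  proof -
    have "(\<Sum>i\<in>UNIV. \<Sum>j\<in>UNIV. D i j * (x $ i * x $ j)) =
       (\<Sum>i\<in>UNIV. \<Sum>j\<in>UNIV. if j = i then D i i * (x $ i * x $ i) else 0)"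
      by (intro sum.cong refl) (auto simp: D_def)
    also have "\<dots> = (\<Sum>i\<in>UNIV. D i i * (x $ i)\<^sup>2)" by (simp add: power2_eq_square)
    also have "\<dots> = 2 * (\<Sum>i\<in>UNIV. \<Sum>j\<in>UNIV. W i j * (x $ i)\<^sup>2)
        + (\<Sum>i\<in>UNIV. of_bool (\<phi> i \<notin> ?V) * (x $ i)\<^sup>2)"
      by (simp add: D_def algebra_simps sum.distrib sum_distrib_left)
    finally have 1: "(\<Sum>i\<in>UNIV. \<Sum>j\<in>UNIV. D i j * (x $ i * x $ j)) = \<dots>" .
    have 2: "(\<Sum>i\<in>UNIV. \<Sum>j\<in>UNIV. W i j * (x $ j)\<^sup>2) = (\<Sum>i\<in>UNIV. \<Sum>j\<in>UNIV. W i j * (x $ i)\<^sup>2)"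
      by (subst sum.swap) (simp add: W_sym)
    have "(\<Sum>i\<in>UNIV. \<Sum>j\<in>UNIV. W i j * (x $ i - x $ j)\<^sup>2) =
      (\<Sum>i\<in>UNIV. \<Sum>j\<in>UNIV. W i j * (x $ i)\<^sup>2) + (\<Sum>i\<in>UNIV. \<Sum>j\<in>UNIV. W i j * (x $ j)\<^sup>2)
      - 2 * (\<Sum>i\<in>UNIV. \<Sum>j\<in>UNIV. W i j * (x $ i * x $ j))"
      unfolding sum_distrib_left sum.distrib[symmetric] sum_subtractf[symmetric]
      by (intro sum.cong refl) (simp add: power2_eq_square algebra_simps)
    moreover have "(\<Sum>i\<in>UNIV. \<Sum>j\<in>UNIV. (D i j - 2 * W i j) * (x $ i * x $ j)) =
      (\<Sum>i\<in>UNIV. \<Sum>j\<in>UNIV. D i j * (x $ i * x $ j)) - 2 * (\<Sum>i\<in>UNIV. \<Sum>j\<in>UNIV. W i j * (x $ i * x $ j))"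
      unfolding sum_distrib_left sum_subtractf[symmetric]
      by (intro sum.cong refl) (simp add: algebra_simps)
    ultimately show ?thesis using 1 2 by (simp add: p_def)
  qed
  have A_form: "x \<bullet> (A M *v x) = q x + M * p x" for M x
  proof -
    have "x \<bullet> (A M *v x) = ((\<Sum>i\<in>UNIV. \<Sum>j\<in>UNIV. B i j * (x $ i * x $ j)) +
       (\<Sum>i\<in>UNIV. \<Sum>j\<in>UNIV. B j i * (x $ i * x $ j))) / 2
       + M * (\<Sum>i\<in>UNIV. \<Sum>j\<in>UNIV. (D i j - 2 * W i j) * (x $ i * x $ j))"
      unfolding quadratic_form_expand sum_distrib_left sum.distrib[symmetric] sum_divide_distrib
      by (intro sum.cong refl) (simp add: A_def field_simps)
    then show ?thesis by (simp add: B_form B_form' D_form)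
  qed
  define K where "K = {x :: real^'n. norm x = 1} \<inter> {x. \<forall>i. 0 \<le> x $ i}"
  have "\<exists>M\<ge>0. \<forall>x\<in>K. 0 < q x + M * p x"
  proof (rule exists_positive_penalty)
    have "closed {x :: real^'n. \<forall>i. 0 \<le> x $ i}"
      by (intro closed_Collect_all closed_Collect_le continuous_intros)
    then show "compact K"
      unfolding K_def using compact_sphere[of "0 :: real^'n" 1]
      by (simp add: sphere_def compact_Int_closed)
    show "continuous_on K q" unfolding q_def by (intro continuous_intros)
    show "continuous_on K p" unfolding p_def by (intro continuous_intros)
    show "0 \<le> p x" for x by (simp add: p_def W_def sum_nonneg)
    fix x assume x: "x \<in> K" and px: "p x = 0"
    have "0 \<le> (\<Sum>i\<in>UNIV. \<Sum>j\<in>UNIV. W i j * (x $ i - x $ j)\<^sup>2)"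
      "0 \<le> (\<Sum>i\<in>UNIV. of_bool (\<phi> i \<notin> ?V) * (x $ i)\<^sup>2)"
      by (auto simp: W_def intro!: sum_nonneg)
    then have z: "(\<Sum>i\<in>UNIV. \<Sum>j\<in>UNIV. W i j * (x $ i - x $ j)\<^sup>2) = 0"
      "(\<Sum>i\<in>UNIV. of_bool (\<phi> i \<notin> ?V) * (x $ i)\<^sup>2) = 0"
      using px unfolding p_def by linarith+
    have edge_eq: "x $ i = x $ j" if "W i j \<noteq> 0" for i j
    proof -
      have "\<forall>i\<in>UNIV. (\<Sum>j\<in>UNIV. W i j * (x $ i - x $ j)\<^sup>2) = 0"
        using z(1) by (subst (asm) sum_nonneg_eq_0_iff) (auto simp: W_def intro!: sum_nonneg)
      then have "\<forall>j\<in>UNIV. W i j * (x $ i - x $ j)\<^sup>2 = 0"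
        by (subst (asm) sum_nonneg_eq_0_iff) (auto simp: W_def)
      then have "W i j * (x $ i - x $ j)\<^sup>2 = 0" by blast
      then show ?thesis using that by simp
    qed
    have outside: "x $ i = 0" if "\<phi> i \<notin> ?V" for i
    proof -
      have "\<forall>i\<in>UNIV. of_bool (\<phi> i \<notin> ?V) * (x $ i)\<^sup>2 = 0"
        using z(2) by (subst (asm) sum_nonneg_eq_0_iff) auto
      then have "of_bool (\<phi> i \<notin> ?V) * (x $ i)\<^sup>2 = 0" by blast
      then show ?thesis using that by simp
    qed
    have const: "x $ i = x $ j" if "\<phi> i = \<phi> j" "\<phi> i \<in> ?V" for i j
    proof -
      have "(fibre_adj G \<phi>)\<^sup>*\<^sup>* i j" using that by (rule conn)
      then have "x $ i = x $ j \<and> \<phi> i = \<phi> j"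
      proof (induction rule: rtranclp_induct)
        case (step k l)
        then have "W k l \<noteq> 0" using that(2) by (simp add: fibre_adj_def W_def)
        then have "x $ k = x $ l" by (rule edge_eq)
        then show ?case using step by (simp add: fibre_adj_def)
      qed simp
      then show ?thesis ..
    qed
    \<comment> \<open>A zero of the penalty is pulled back from a vector on \<open>H\<close>.\<close>
    define y where "y h = x $ (SOME i. \<phi> i = h)" for h
    have y: "x $ i = y (\<phi> i)" if "\<phi> i \<in> ?V" for i
      unfolding y_def by (rule const) (use that in \<open>auto intro: someI2[of _ i]\<close>)
    have "q x = quad_form ?V a y"
      unfolding q_def quad_form_def by (intro sum.cong refl) (use rs y in auto)
    moreover have "0 < quad_form ?V a y"
    proof (rule pos)
      show "0 \<le> y h" for h using x by (simp add: y_def K_def)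
      have "x \<noteq> 0" using x by (auto simp: K_def)
      then obtain i where "x $ i \<noteq> 0" by (auto simp: vec_eq_iff)
      then show "\<exists>h\<in>?V. y h \<noteq> 0" using outside y by metis
    qed
    ultimately show "0 < q x" by simp
  qed
  then obtain M where M: "\<And>x. x \<in> K \<Longrightarrow> 0 < q x + M * p x" by blast
  have A_sym: "A M $ i $ j = A M $ j $ i" for i j
    by (simp add: A_def D_def W_sym add.commute)
  have cop: "copositive (A M)"
    unfolding copositive_def
  proof (intro conjI allI impI)
    show "symmetric_matrix (A M)"
      unfolding symmetric_matrix_def transpose_def vec_eq_iff using A_sym by simp
    fix x :: "real^'n" assume x: "\<forall>i. 0 \<le> x $ i"
    show "0 \<le> x \<bullet> (A M *v x)"
    proof (cases "x = 0")
      case False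
      then have "x /\<^sub>R norm x \<in> K" using x by (simp add: K_def)
      then have "0 < (x /\<^sub>R norm x) \<bullet> (A M *v (x /\<^sub>R norm x))" unfolding A_form by (rule M)
      also have "\<dots> = (x \<bullet> (A M *v x)) / (norm x)\<^sup>2"
        by (simp add: matrix_vector_mult_scaleR power2_eq_square divide_inverse)
      finally show ?thesis using False by (simp add: zero_less_divide_iff)
    qed simp
  qed
  define X :: "'i \<Rightarrow> real^'n" where "X k = (\<chi> i. if \<phi> i \<in> ?V then w k (\<phi> i) else 0)" for k
  have "0 \<le> (\<Sum>k\<in>I. X k \<bullet> (A M *v X k))"
  proof (rule spn_graph_form_sum_nonneg[OF G cop])
    fix i j :: 'n
    show "0 \<le> (\<Sum>k\<in>I. X k $ i * X k $ j)"
      using gram[of "\<phi> i" "\<phi> j"] by (cases "\<phi> i \<in> ?V \<and> \<phi> j \<in> ?V") (auto simp: X_def)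
    assume ij: "i \<noteq> j" "A M $ i $ j \<noteq> 0"
    have B_edge: "{i', j'} \<in> edges G" if ne: "B i' j' \<noteq> 0" "i' \<noteq> j'" for i' j'
    proof -
      obtain h l where hl: "h \<in> ?V" "l \<in> ?V" "a h l * (of_bool (i' = r h l) * of_bool (j' = s h l)) \<noteq> 0"
        using ne(1) unfolding B_def by (metis (no_types, lifting) sum.neutral)
      then show ?thesis using rs[OF hl(1,2)] ne(2) by (auto split: if_splits)
    qed
    show "{i, j} \<in> edges G"
    proof (rule ccontr)
      assume no: "{i, j} \<notin> edges G"
      then have "B i j = 0" "B j i = 0" using B_edge[of i j] B_edge[of j i] ij(1) by (auto simp: insert_commute)
      then show False using ij no by (simp add: A_def D_def W_def)
    qed
  qed
  also have "(\<Sum>k\<in>I. X k \<bullet> (A M *v X k)) = (\<Sum>k\<in>I. quad_form ?V a (w k))"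
  proof (intro sum.cong refl)
    fix k
    have "p (X k) = 0" by (auto simp: p_def W_def X_def intro!: sum.neutral)
    moreover have "q (X k) = quad_form ?V a (w k)"
      unfolding q_def quad_form_def by (intro sum.cong refl) (use rs in \<open>auto simp: X_def\<close>)
    ultimately show "X k \<bullet> (A M *v X k) = quad_form ?V a (w k)" by (simp add: A_form)
  qed
  finally show ?thesis .
qed

section \<open>Minors of subdivisions\<close>

lemma path_edges_eq_image: "path_edges p = (\<lambda>i. {p ! i, p ! Suc i}) ` {..<length p - 1}"
  by (auto simp: path_edges_def)

lemma path_edges_Cons: "path_edges (x # y # zs) = insert {x, y} (path_edges (y # zs))"
  by (simp add: path_edges_eq_image lessThan_Suc_eq_insert_0 image_image)

lemma path_edges_append_mono: "path_edges q \<subseteq> path_edges (as @ q @ bs)"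
proof
  fix d assume "d \<in> path_edges q"
  then obtain i where i: "Suc i < length q" "d = {q ! i, q ! Suc i}" by (auto simp: path_edges_def)
  then have "d = {(as @ q @ bs) ! (length as + i), (as @ q @ bs) ! Suc (length as + i)}"
    by (simp add: nth_append)
  then show "d \<in> path_edges (as @ q @ bs)" using i(1) unfolding path_edges_def by force
qed

lemma fibre_adj_rtranclp_sym:
  assumes "(fibre_adj G \<phi>)\<^sup>*\<^sup>* u v"
  shows "(fibre_adj G \<phi>)\<^sup>*\<^sup>* v u"
proof -
  have "symp (fibre_adj G \<phi>)" by (auto intro!: sympI simp: fibre_adj_def insert_commute)
  then show ?thesis using assms by (meson symp_rtranclp sympD)
qed

lemma path_fibre_connected:
  assumes "path_edges q \<subseteq> edges G" "\<forall>v\<in>set q. \<phi> v = h" "u \<in> set q" "v \<in> set q"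
  shows "(fibre_adj G \<phi>)\<^sup>*\<^sup>* u v"
proof -
  have "\<forall>v\<in>set q. (fibre_adj G \<phi>)\<^sup>*\<^sup>* (hd q) v"
    using assms(1,2)
  proof (induction q)
    case (Cons x q)
    show ?case
    proof (cases q)
      case (Cons y zs)
      then have "fibre_adj G \<phi> x y" using Cons.prems by (simp add: fibre_adj_def path_edges_Cons)
      moreover have "\<forall>v\<in>set q. (fibre_adj G \<phi>)\<^sup>*\<^sup>* y v"
        using Cons.IH Cons.prems Cons by (simp add: path_edges_Cons)
      ultimately show ?thesis by (auto intro: converse_rtranclp_into_rtranclp)
    qed simp
  qed simp
  then show ?thesis using assms(3,4) fibre_adj_rtranclp_sym rtranclp_trans by metis
qed

text \<open>
  A two-valued map along a path changes its value somewhere; this yields the edge between two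
  branch sets that share a subdivided edge.
\<close>

lemma path_edges_crossing:
  assumes "q \<noteq> []" "\<phi> (hd q) = h" "\<phi> (last q) = l" "\<forall>v\<in>set q. \<phi> v \<in> {h, l}" "h \<noteq> l"
  shows "\<exists>u v. {u, v} \<in> path_edges q \<and> \<phi> u = h \<and> \<phi> v = l"
  using assms
proof (induction q)
  case (Cons x q)
  show ?case
  proof (cases q)
    case Nil
    then show ?thesis using Cons.prems by auto
  next
    case (Cons y zs)
    show ?thesis
    proof (cases "\<phi> y = h")
      case True
      then have "\<exists>u v. {u, v} \<in> path_edges q \<and> \<phi> u = h \<and> \<phi> v = l"
        using Cons.IH Cons.prems Cons by auto
      then show ?thesis using Cons by (auto simp: path_edges_Cons)
    next
      case False
      then have "\<phi> x = h" "\<phi> y = l" using Cons.prems Cons by auto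
      then show ?thesis using Cons by (auto simp: path_edges_Cons)
    qed
  qed
qed simp

text \<open>
  Minors of a subdivision that are described on \<open>H\<close> alone: \<open>\<psi>\<close> gives the branch set of each branch
  vertex, and \<open>g e\<close> the one that receives all inner vertices of the path replacing \<open>e\<close>. Such a path
  is either absorbed by the branch set of one of its ends or, if it has inner vertices, may form
  a branch set of its own; \<open>absorbed\<close> says that nothing else happens, which keeps branch sets
  connected. An edge of \<open>K\<close> then arises either between the two ends of a path or between one end
  and the inner vertices. The value \<open>none\<close> marks the vertices of \<open>G\<close>
  outside the subdivision.
\<close>

lemma subdivision_minor_model:
  fixes H :: "'b graph" and K :: "'c graph" and S G :: "'a graph"
  assumes sub: "subdivision_by H k S" and SG: "edges S \<subseteq> edges G"
    and H: "simple_graph H" and unused: "none \<notin> verts K"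
    and surj: "\<And>h. h \<in> verts K \<Longrightarrow> h \<in> \<psi> ` verts H \<or> (\<exists>e\<in>edges H. 1 \<le> k e \<and> g e = h)"
    and joined: "\<And>d. d \<in> edges K \<Longrightarrow> card d = 2 \<and> (\<exists>a b. {a, b} \<in> edges H \<and>
      (d = {\<psi> a, \<psi> b} \<and> g {a, b} \<in> d \<or> 1 \<le> k {a, b} \<and> d = {\<psi> a, g {a, b}}))"
    and contracted: "\<And>a b. a \<in> verts H \<Longrightarrow> b \<in> verts H \<Longrightarrow> \<psi> a = \<psi> b \<Longrightarrow> a \<noteq> b \<Longrightarrow>
      {a, b} \<in> edges H \<and> g {a, b} = \<psi> a"
    and absorbed: "\<And>e. e \<in> edges H \<Longrightarrow>
      g e \<in> \<psi> ` e \<or> g e \<notin> \<psi> ` verts H \<and> (\<forall>e'\<in>edges H. g e' = g e \<longrightarrow> e' = e)"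
  shows "\<exists>\<phi>. minor_model K \<phi> G"
proof -
  obtain f p where inj: "inj_on f (verts H)"
    and p0: "\<forall>e\<in>edges H. distinct (p e) \<and> length (p e) = k e + 2 \<and>
         {hd (p e), last (p e)} = f ` e \<and> inner_verts (p e) \<inter> f ` verts H = {}"
    and disj0: "\<forall>e\<in>edges H. \<forall>e'\<in>edges H. e \<noteq> e' \<longrightarrow> inner_verts (p e) \<inter> inner_verts (p e') = {}"
    and "verts S = f ` verts H \<union> (\<Union>e\<in>edges H. inner_verts (p e))"
    and S: "edges S = (\<Union>e\<in>edges H. path_edges (p e))"
    using sub unfolding subdivision_by_def by (elim exE conjE) (rule that)
  have p: "length (p e) = k e + 2" "{hd (p e), last (p e)} = f ` e" "inner_verts (p e) \<inter> f ` verts H = {}"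
    if "e \<in> edges H" for e
    using p0 that by simp_all
  have disj: "inner_verts (p e) \<inter> inner_verts (p e') = {}" if "e \<in> edges H" "e' \<in> edges H" "e \<noteq> e'" for e e'
    using disj0 that by simp
  define \<phi> where "\<phi> v = (if v \<in> f ` verts H then \<psi> (inv_into (verts H) f v)
    else if \<exists>e\<in>edges H. v \<in> inner_verts (p e) then g (SOME e. e \<in> edges H \<and> v \<in> inner_verts (p e))
    else none)" for v
  have \<phi>_vert: "\<phi> (f a) = \<psi> a" if "a \<in> verts H" for a
    using that inj by (simp add: \<phi>_def)
  have \<phi>_inner: "\<phi> v = g e" if e: "e \<in> edges H" "v \<in> inner_verts (p e)" for v e
  proof -
    have out: "v \<notin> f ` verts H" using p(3)[OF e(1)] e(2) by blast
    have ex: "\<exists>e\<in>edges H. v \<in> inner_verts (p e)" using e by blast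
    have "(SOME e. e \<in> edges H \<and> v \<in> inner_verts (p e)) = e"
    proof (rule some_equality)
      fix e' assume "e' \<in> edges H \<and> v \<in> inner_verts (p e')"
      then show "e' = e" using disj[of e' e] e by blast
    qed (use e in simp)
    then show ?thesis unfolding \<phi>_def if_not_P[OF out] if_P[OF ex] by simp
  qed
  have \<phi>_cases: "(\<exists>a\<in>verts H. v = f a) \<or> (\<exists>e\<in>edges H. v \<in> inner_verts (p e))"
    if v: "\<phi> v \<in> verts K" for v
  proof (rule ccontr)
    assume neg: "\<not> ?thesis"
    then have out: "v \<notin> f ` verts H" by blast
    have no: "\<not> (\<exists>e\<in>edges H. v \<in> inner_verts (p e))" using neg by blast
    have "\<phi> v = none" unfolding \<phi>_def if_not_P[OF out] if_not_P[OF no] ..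
    then show False using v unused by simp
  qed
  have sub_verts: "a \<in> verts H" if "e \<in> edges H" "a \<in> e" for a e
    using H that unfolding simple_graph_def by blast
  have path: "\<exists>m x y. p e = x # m @ [y] \<and> set m = inner_verts (p e) \<and> length m = k e \<and>
      {x, y} = f ` e \<and> path_edges (p e) \<subseteq> edges G" if e: "e \<in> edges H" for e
  proof -
    have len: "length (p e) = Suc (Suc (k e))" using p(1)[OF e] by simp
    then obtain x q where q: "p e = x # q" "length q = Suc (k e)" by (cases "p e") auto
    then obtain m y where m: "q = m @ [y]" by (cases q rule: rev_cases) auto
    have "path_edges (p e) \<subseteq> edges G" using e S SG by blast
    moreover have "{x, y} = f ` e" using p(2)[OF e] q(1) m by simp
    moreover have "set m = inner_verts (p e)" "length m = k e" using q m by (simp_all add: inner_verts_def)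
    ultimately show ?thesis using q(1) m by blast
  qed
  let ?R = "(fibre_adj G \<phi>)\<^sup>*\<^sup>*"
  have R_sym: "?R v u" if "?R u v" for u v using that by (rule fibre_adj_rtranclp_sym)
  have R_vert: "?R (f a) (f b)" if ab: "a \<in> verts H" "b \<in> verts H" "\<psi> a = \<psi> b" for a b
  proof (cases "a = b")
    case False
    then have e: "{a, b} \<in> edges H" "g {a, b} = \<psi> a" using contracted[OF ab] by blast+
    obtain m x y where m: "p {a, b} = x # m @ [y]" "set m = inner_verts (p {a, b})"
      "{x, y} = f ` {a, b}" "path_edges (p {a, b}) \<subseteq> edges G"
      using path[OF e(1)] by blast
    have ends: "x = f a \<and> y = f b \<or> x = f b \<and> y = f a" using m(3) by (simp add: doubleton_eq_iff)
    have "\<forall>v\<in>set m. \<phi> v = \<psi> a" using \<phi>_inner[OF e(1)] e(2) m(2) by simp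
    moreover have "\<phi> x = \<psi> a" "\<phi> y = \<psi> a" 
      using ends \<phi>_vert[OF ab(1)] \<phi>_vert[OF ab(2)] ab(3) by (elim disjE conjE; simp)+
    ultimately have "\<forall>v\<in>set (p {a, b}). \<phi> v = \<psi> a" by (simp add: m(1))
    moreover have "f a \<in> set (p {a, b})" "f b \<in> set (p {a, b})"
      unfolding m(1) using ends by (elim disjE conjE; simp)+
    ultimately show ?thesis by (intro path_fibre_connected[OF m(4)])
  qed simp
  have R_inner: "?R u v" if e: "e \<in> edges H" and uv: "u \<in> inner_verts (p e)" "v \<in> inner_verts (p e)" for e u v
  proof -
    obtain m x y where m: "p e = x # m @ [y]" "set m = inner_verts (p e)" "path_edges (p e) \<subseteq> edges G"
      using path[OF e] by blast
    have "path_edges m \<subseteq> edges G" using path_edges_append_mono[of m "[x]" "[y]"] m(1,3) by auto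
    moreover have "\<forall>v\<in>set m. \<phi> v = g e" using \<phi>_inner[OF e] m(2) by simp
    ultimately show ?thesis using uv unfolding m(2)[symmetric] by (intro path_fibre_connected)
  qed
  have R_end: "?R u (f a)" if e: "e \<in> edges H" and u: "u \<in> inner_verts (p e)"
    and a: "a \<in> e" "g e = \<psi> a" for e u a
  proof -
    obtain m x y where m: "p e = x # m @ [y]" "set m = inner_verts (p e)" "{x, y} = f ` e"
      "path_edges (p e) \<subseteq> edges G"
      using path[OF e] by blast
    have mid: "\<forall>v\<in>set m. \<phi> v = g e" using \<phi>_inner[OF e] m(2) by simp
    have fa: "\<phi> (f a) = g e" using \<phi>_vert sub_verts[OF e] a by simp
    have "f a \<in> {x, y}" using m(3) a(1) by blast
    then consider "f a = x" | "f a = y" by blast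
    then show ?thesis
    proof cases
      case 1
      have "path_edges (x # m) \<subseteq> edges G" using path_edges_append_mono[of "x # m" "[]" "[y]"] m(1,4) by auto
      moreover have "\<forall>v\<in>set (x # m). \<phi> v = g e" using mid fa 1 by simp
      moreover have "u \<in> set (x # m)" "f a \<in> set (x # m)" using u 1 by (simp_all add: m(2))
      ultimately show ?thesis by (intro path_fibre_connected)
    next
      case 2
      have "path_edges (m @ [y]) \<subseteq> edges G" using path_edges_append_mono[of "m @ [y]" "[x]" "[]"] m(1,4) by auto
      moreover have "\<forall>v\<in>set (m @ [y]). \<phi> v = g e" using mid fa 2 by simp
      moreover have "u \<in> set (m @ [y])" "f a \<in> set (m @ [y])" using u 2 by (simp_all add: m(2))
      ultimately show ?thesis by (intro path_fibre_connected)
    qed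
  qed
  have R_inner_vert: "?R u (f a)" if e: "e \<in> edges H" and u: "u \<in> inner_verts (p e)"
    and a: "a \<in> verts H" "g e = \<psi> a" for e u a
  proof -
    have "g e \<in> \<psi> ` verts H" using a by simp
    then obtain b where b: "b \<in> e" "g e = \<psi> b" using absorbed[OF e] by blast
    have "?R u (f b)" using e u b by (rule R_end)
    also have "?R (f b) (f a)" using R_vert[OF sub_verts[OF e b(1)] a(1)] a(2) b(2) by simp
    finally show ?thesis .
  qed
  have "minor_model K \<phi> G"
    unfolding minor_model_def
  proof (intro conjI subsetI ballI allI impI)
    fix h assume "h \<in> verts K"
    then consider a where "a \<in> verts H" "h = \<psi> a" | e where "e \<in> edges H" "1 \<le> k e" "g e = h"
      using surj by blast
    then show "h \<in> range \<phi>"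
    proof cases
      case 1
      then show ?thesis by (metis \<phi>_vert rangeI)
    next
      case 2
      obtain m x y where "set m = inner_verts (p e)" "length m = k e" using path[OF 2(1)] by blast
      moreover from this have "m \<noteq> []" using 2(2) by auto
      ultimately obtain v where "v \<in> inner_verts (p e)" by (metis list.set_sel(1))
      then show ?thesis using \<phi>_inner[OF 2(1)] 2(3) by (metis rangeI)
    qed
  next
    fix d assume d: "d \<in> edges K"
    then obtain a b where ab: "{a, b} \<in> edges H" "card d = 2"
      "d = {\<psi> a, \<psi> b} \<and> g {a, b} \<in> d \<or> 1 \<le> k {a, b} \<and> d = {\<psi> a, g {a, b}}"
      using joined by blast
    have V: "a \<in> verts H" "b \<in> verts H" using sub_verts[OF ab(1)] by auto
    obtain m x y where m: "p {a, b} = x # m @ [y]" "set m = inner_verts (p {a, b})" "length m = k {a, b}"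
      "{x, y} = f ` {a, b}" "path_edges (p {a, b}) \<subseteq> edges G"
      using path[OF ab(1)] by blast
    have xy_ends: "x = f a \<and> y = f b \<or> x = f b \<and> y = f a" using m(4) by (simp add: doubleton_eq_iff)
    have mid: "\<forall>v\<in>set m. \<phi> v = g {a, b}" using \<phi>_inner[OF ab(1)] m(2) by simp
    show "\<exists>u v. {u, v} \<in> edges G \<and> d = {\<phi> u, \<phi> v}"
      using ab(3)
    proof (elim disjE conjE)
      assume dd: "d = {\<psi> a, \<psi> b}" and gd: "g {a, b} \<in> d"
      have xy: "{\<phi> x, \<phi> y} = d" using xy_ends dd \<phi>_vert[OF V(1)] \<phi>_vert[OF V(2)] by auto
      then have "\<phi> x \<noteq> \<phi> y" using ab(2) by auto
      moreover have "\<forall>v\<in>set (p {a, b}). \<phi> v \<in> {\<phi> x, \<phi> y}" using mid gd unfolding m(1) xy[symmetric] by auto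
      ultimately have "\<exists>u v. {u, v} \<in> path_edges (p {a, b}) \<and> \<phi> u = \<phi> x \<and> \<phi> v = \<phi> y"
        by (intro path_edges_crossing) (auto simp: m(1))
      then show ?thesis using m(5) xy by (metis subsetD)
    next
      assume k: "1 \<le> k {a, b}" and dd: "d = {\<psi> a, g {a, b}}"
      then have "m \<noteq> []" using m(3) by auto
      then have ends: "{x, hd m} \<in> edges G" "{last m, y} \<in> edges G" "hd m \<in> set m" "last m \<in> set m"
      proof -
        obtain z zs where "m = z # zs" using \<open>m \<noteq> []\<close> by (cases m) auto
        then show "{x, hd m} \<in> edges G" using m(1,5) by (simp add: path_edges_Cons)
        obtain zs' z' where "m = zs' @ [z']" using \<open>m \<noteq> []\<close> by (cases m rule: rev_cases) auto
        moreover have "{z', y} \<in> path_edges [z', y]" by (simp add: path_edges_Cons)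
        ultimately show "{last m, y} \<in> edges G"
          using m(1,5) path_edges_append_mono[of "[z', y]" "x # zs'" "[]"] by auto
      qed (use \<open>m \<noteq> []\<close> in auto)
      have "f a = x \<or> f a = y" using xy_ends by blast
      then show ?thesis
      proof
        assume "f a = x"
        then show ?thesis using ends(1,3) mid dd \<phi>_vert[OF V(1)] by metis
      next
        assume "f a = y"
        then show ?thesis using ends(2,4) mid dd \<phi>_vert[OF V(1)] by (metis insert_commute)
      qed
    qed
  next
    fix u v assume uv: "\<phi> u = \<phi> v" "\<phi> u \<in> verts K"
    then have "\<phi> v \<in> verts K" by simp
    from \<phi>_cases[OF uv(2)] \<phi>_cases[OF this] show "?R u v"
    proof (elim disjE bexE)
      fix a b assume "a \<in> verts H" "u = f a" "b \<in> verts H" "v = f b"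
      then show ?thesis using R_vert[of a b] uv(1) \<phi>_vert by simp
    next
      fix a e assume "a \<in> verts H" "u = f a" "e \<in> edges H" "v \<in> inner_verts (p e)"
      then show ?thesis using R_sym[OF R_inner_vert[of e v a]] uv(1) \<phi>_vert \<phi>_inner by simp
    next
      fix a e assume "a \<in> verts H" "v = f a" "e \<in> edges H" "u \<in> inner_verts (p e)"
      then show ?thesis using R_inner_vert[of e u a] uv(1) \<phi>_vert \<phi>_inner by simp
    next
      fix e e' assume e: "e \<in> edges H" "u \<in> inner_verts (p e)" "e' \<in> edges H" "v \<in> inner_verts (p e')"
      then have gg: "g e = g e'" using uv(1) \<phi>_inner by simp
      show ?thesis
      proof (cases "e = e'")
        case True
        then show ?thesis using R_inner[OF e(1,2)] e(4) by simp
      next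
        case False
        then obtain a where a: "a \<in> e" "g e = \<psi> a" using absorbed[OF e(1)] gg e(3) by fastforce
        have "?R u (f a)" using e(1,2) a by (rule R_end)
        also have "?R (f a) v" using R_sym[OF R_inner_vert[OF e(3,4) sub_verts[OF e(1) a(1)]]] gg a(2) by simp
        finally show ?thesis .
      qed
    qed
  qed
  then show ?thesis by (rule exI[of _ \<phi>])
qed

text \<open>
  If \<open>K\<close> arises from \<open>H\<close> by contracting edges, every path can be absorbed by an end, whatever the
  numbers of subdivisions are.
\<close>

lemma subdivision_contraction_minor_model:
  fixes H :: "'b graph" and K :: "'c graph" and S G :: "'a graph"
  assumes sub: "subdivision H S" and SG: "edges S \<subseteq> edges G"
    and H: "simple_graph H" and K: "simple_graph K" and unused: "none \<notin> verts K"
    and surj: "verts K \<subseteq> \<psi> ` verts H"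
    and joined: "edges K \<subseteq> (`) \<psi> ` edges H"
    and contracted: "\<And>a b. a \<in> verts H \<Longrightarrow> b \<in> verts H \<Longrightarrow> \<psi> a = \<psi> b \<Longrightarrow> a \<noteq> b \<Longrightarrow> {a, b} \<in> edges H"
  shows "\<exists>\<phi>. minor_model K \<phi> G"
proof -
  obtain k where k: "subdivision_by H k S" using sub by (auto simp: subdivision_def)
  define g where "g e = (SOME h. h \<in> \<psi> ` e)" for e
  have g: "g e \<in> \<psi> ` e" if "e \<noteq> {}" for e
    unfolding g_def by (rule someI_ex) (use that in auto)
  have pair: "e \<noteq> {}" "\<exists>a b. e = {a, b}" if e: "e \<in> edges H" for e
  proof -
    have "card e = 2" using H e by (simp add: simple_graph_def)
    then show "e \<noteq> {}" "\<exists>a b. e = {a, b}" unfolding card_2_iff by blast+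
  qed
  show ?thesis
  proof (rule subdivision_minor_model[OF k SG H unused, where \<psi> = \<psi> and g = g])
    fix d assume d: "d \<in> edges K"
    then obtain e where e: "e \<in> edges H" "d = \<psi> ` e" using joined by blast
    obtain a b where ab: "e = {a, b}" using pair(2)[OF e(1)] by blast
    have "card d = 2" using K d by (auto simp: simple_graph_def)
    moreover have "d = {\<psi> a, \<psi> b}" "g {a, b} \<in> d" using g[OF pair(1)[OF e(1)]] e ab by auto
    ultimately show "card d = 2 \<and> (\<exists>a b. {a, b} \<in> edges H \<and>
      (d = {\<psi> a, \<psi> b} \<and> g {a, b} \<in> d \<or> 1 \<le> k {a, b} \<and> d = {\<psi> a, g {a, b}}))"
      using e(1) ab by blast
  next
    fix a b assume "a \<in> verts H" "b \<in> verts H" "\<psi> a = \<psi> b" "a \<noteq> b"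
    moreover from this have "g {a, b} = \<psi> a" using g[of "{a, b}"] by simp
    ultimately show "{a, b} \<in> edges H \<and> g {a, b} = \<psi> a" using contracted by blast
  next
    fix e assume "e \<in> edges H"
    then show "g e \<in> \<psi> ` e \<or> g e \<notin> \<psi> ` verts H \<and> (\<forall>e'\<in>edges H. g e' = g e \<longrightarrow> e' = e)"
      using g[OF pair(1)] by blast
  next
    fix h assume "h \<in> verts K"
    then show "h \<in> \<psi> ` verts H \<or> (\<exists>e\<in>edges H. 1 \<le> k e \<and> g e = h)" using surj by blast
  qed
qed

section \<open>Subdivisions with a fan minor\<close>

lemma simple_graph_F5: "simple_graph F5"
  by (simp add: simple_graph_def F5_def)

lemma subdivision_F5_minor_model:
  assumes "subdivision F5 S" "edges S \<subseteq> edges G"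
  shows "\<exists>\<phi>. minor_model F5 \<phi> G"
proof (rule subdivision_contraction_minor_model[OF assms simple_graph_F5 simple_graph_F5])
  show "0 \<notin> verts F5" by (simp add: F5_def)
  show "verts F5 \<subseteq> id ` verts F5" "edges F5 \<subseteq> (`) id ` edges F5" by simp_all
qed simp

text \<open>
  Contracting the edge \<open>34\<close> of \<open>CD6\<close> gives a hub adjacent to \<open>1, 2, 5, 6\<close>, which form a path in this
  order.
\<close>

lemma subdivision_CD6_minor_model:
  assumes "subdivision CD6 S" "edges S \<subseteq> edges G"
  shows "\<exists>\<phi>. minor_model F5 \<phi> G"
proof -
  define \<psi> :: "nat \<Rightarrow> nat" where
    "\<psi> v = (if v = 3 \<or> v = 4 then 5 else if v = 5 then 3 else if v = 6 then 4 else v)" for v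
  have \<psi>: "\<psi> 1 = 1" "\<psi> 2 = 2" "\<psi> 3 = 5" "\<psi> 4 = 5" "\<psi> 5 = 3" "\<psi> 6 = 4" by (simp_all add: \<psi>_def)
  have V: "verts CD6 = {1, 2, 3, 4, 5, 6}" "verts F5 = {1, 2, 3, 4, 5}"
    by (auto simp: CD6_def F5_def)
  have E: "{1, 2} \<in> edges CD6" "{1, 3} \<in> edges CD6" "{2, 3} \<in> edges CD6" "{2, 5} \<in> edges CD6"
    "{4, 5} \<in> edges CD6" "{4, 6} \<in> edges CD6" "{5, 6} \<in> edges CD6" "{3, 4} \<in> edges CD6"
    by (simp_all add: CD6_def)
  have "simple_graph CD6" by (simp add: simple_graph_def CD6_def)
  then show ?thesis
  proof (rule subdivision_contraction_minor_model[OF assms _ simple_graph_F5])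
    show "0 \<notin> verts F5" by (simp add: F5_def)
    show "verts F5 \<subseteq> \<psi> ` verts CD6" by (simp only: V image_insert image_empty \<psi>) simp
    have "edges F5 = (`) \<psi> ` {{1, 2}, {1, 3}, {2, 3}, {2, 5}, {4, 5}, {4, 6}, {5, 6}}"
      by (simp only: image_insert image_empty \<psi>) (simp add: F5_def insert_commute)
    then show "edges F5 \<subseteq> (`) \<psi> ` edges CD6" using E by blast
    fix a b assume ab: "a \<in> verts CD6" "b \<in> verts CD6" "\<psi> a = \<psi> b" "a \<noteq> b"
    then have "a = 3 \<and> b = 4 \<or> a = 4 \<and> b = 3" by (auto simp: V \<psi>_def split: if_splits)
    then show "{a, b} \<in> edges CD6" using E(8) by (auto simp: insert_commute)
  qed
qed

text \<open>
  This treats adjacent and opposite pairs of edges alike: take \<open>s \<in> e - e'\<close> and \<open>t \<in> e' - e\<close>.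
\<close>

lemma two_K4_edges:
  assumes "e \<in> edges K4" "e' \<in> edges K4" "e \<noteq> e'"
  obtains s t y z where "distinct [s, t, y, z]" "verts K4 = {s, t, y, z}"
    "e = {s, y}" "e' = {t, y} \<or> e' = {t, z}"
proof -
  have edge: "d \<subseteq> {1..4} \<and> card d = 2" if "d \<in> edges K4" for d
    using that by (auto simp: K4_def)
  have fin: "finite e" "finite e'"
    using edge[OF assms(1)] edge[OF assms(2)] by (auto intro: finite_subset[OF _ finite_atLeastAtMost])
  have "\<not> e \<subseteq> e'" "\<not> e' \<subseteq> e"
    using assms edge fin card_subset_eq by metis+
  then obtain s t where st: "s \<in> e" "s \<notin> e'" "t \<in> e'" "t \<notin> e" by blast
  obtain y where y: "e = {s, y}" "y \<noteq> s" using edge[OF assms(1)] st(1) by (auto simp: card_2_iff)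
  obtain x where x: "e' = {t, x}" "x \<noteq> t" using edge[OF assms(2)] st(3) by (auto simp: card_2_iff)
  have sub: "{s, t, y} \<subseteq> {1..4}" using edge[OF assms(1)] edge[OF assms(2)] st y by auto
  have "card {s, t, y} = 3" using st y by auto
  then have "card ({1..4} - {s, t, y}) = 1" using sub by (simp add: card_Diff_subset)
  then obtain z where z: "{1..4} - {s, t, y} = {z}" by (auto simp: card_1_singleton_iff)
  have "{1..4} = {s, t, y, z}" using z sub by blast
  moreover have "distinct [s, t, y, z]" using st y z by auto
  moreover have "x \<in> {1..4}" "x \<noteq> s" using edge[OF assms(2)] x st by auto
  ultimately show ?thesis using that[of s t y z] x y by (auto simp: K4_def)
qed

text \<open>
  The fan has path \<open>e\<close>, \<open>s\<close>, \<open>t\<close>, \<open>e'\<close>, where an edge stands for its inner vertices, and hub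
  \<open>{y, z}\<close>. The inner vertices of \<open>e\<close> and \<open>e'\<close> are adjacent to the hub through the other ends of
  these two edges, and \<open>s\<close> and \<open>t\<close> through their remaining edges to \<open>y\<close> or \<open>z\<close>.
\<close>

lemma subdivision_K4_minor_model:
  assumes sub: "subdivision_by K4 k S" "edges S \<subseteq> edges G"
    and two: "2 \<le> card {e \<in> edges K4. 1 \<le> k e}"
  shows "\<exists>\<phi>. minor_model F5 \<phi> G"
proof -
  obtain e e' where e: "e \<in> edges K4" "1 \<le> k e" "e' \<in> edges K4" "1 \<le> k e'" "e \<noteq> e'"
  proof -
    have "\<not> card {e \<in> edges K4. 1 \<le> k e} \<le> Suc 0" using two by simp
    moreover have "finite (edges K4)"
      by (rule finite_subset[of _ "Pow {1..4}"]) (auto simp: K4_def)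
    ultimately show ?thesis using that by (auto simp: card_le_Suc0_iff_eq)
  qed
  obtain s t y z where st: "distinct [s, t, y, z]" and V: "verts K4 = {s, t, y, z}"
    and sy: "e = {s, y}" and ty: "e' = {t, y} \<or> e' = {t, z}"
    using two_K4_edges[OF e(1,3,5)] by blast
  have E: "edges K4 = {{i, j} | i j. i \<in> {s, t, y, z} \<and> j \<in> {s, t, y, z} \<and> i \<noteq> j}"
    using V by (simp add: K4_def)
  have edge: "{i, j} \<in> edges K4" if "i \<in> {s, t, y, z}" "j \<in> {s, t, y, z}" "i \<noteq> j" for i j
    unfolding E using that by blast
  have edge_cases: "s \<in> d \<or> t \<in> d \<or> d = {y, z}" if d: "d \<in> edges K4" for d
  proof -
    obtain i j where "d = {i, j}" "i \<in> {s, t, y, z}" "j \<in> {s, t, y, z}" "i \<noteq> j"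
      using d unfolding E by blast
    then show ?thesis by (elim insertE emptyE) (simp_all add: insert_commute)
  qed
  define \<psi> :: "nat \<Rightarrow> nat" where "\<psi> v = (if v = s then 2 else if v = t then 3 else 5)" for v
  define g :: "nat set \<Rightarrow> nat" where
    "g d = (if d = e then 1 else if d = e' then 4 else if s \<in> d then 2 else if t \<in> d then 3 else 5)" for d
  have \<psi>: "\<psi> s = 2" "\<psi> t = 3" "\<psi> y = 5" "\<psi> z = 5" using st by (auto simp: \<psi>_def)
  have g: "g e = 1" "g e' = 4" "g {s, t} = 2" "g {s, z} = 2" "g {y, z} = 5"
    using e(5) st ty by (auto simp: g_def sy doubleton_eq_iff)
  \<comment> \<open>The edge \<open>{t, x'}\<close> is the one that joins \<open>t\<close> to the hub and is not \<open>e'\<close>.\<close>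
  obtain x x' where x: "{x, x'} = {y, z}" "e' = {t, x}" "g {t, x'} = 3"
    using ty
  proof
    assume "e' = {t, y}"
    moreover from this have "g {t, z} = 3" using st by (auto simp: g_def sy doubleton_eq_iff)
    ultimately show ?thesis using that[of y z] by blast
  next
    assume "e' = {t, z}"
    moreover from this have "g {t, y} = 3" using st by (auto simp: g_def sy doubleton_eq_iff)
    ultimately show ?thesis using that[of z y] by (auto simp: insert_commute)
  qed
  have x'_cases: "x = y \<and> x' = z \<or> x = z \<and> x' = y" using x(1) by (simp add: doubleton_eq_iff)
  then have xx: "\<psi> x = 5" "\<psi> x' = 5" using \<psi> by (elim disjE conjE; simp)+
  have inE: "{s, t} \<in> edges K4" "{s, z} \<in> edges K4" "{t, x'} \<in> edges K4" "{y, z} \<in> edges K4"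
    by (rule edge; use st x'_cases in auto)+
  show ?thesis
  proof (rule subdivision_minor_model[OF sub, where \<psi> = \<psi> and g = g and none = 0])
    show "simple_graph K4" by (auto simp: simple_graph_def K4_def)
    show "0 \<notin> verts F5" by (simp add: F5_def)
    fix h assume "h \<in> verts F5"
    then have "h \<in> {1, 2, 3, 4, 5}" by (auto simp: F5_def)
    then show "h \<in> \<psi> ` verts K4 \<or> (\<exists>e\<in>edges K4. 1 \<le> k e \<and> g e = h)"
      using \<psi> g e V by auto
  next
    fix d assume d: "d \<in> edges F5"
    then have "d \<in> {{1,2}, {1,5}, {2,3}, {4,3}, {5,4}, {2,5}, {3,5}}" by (auto simp: F5_def insert_commute)
    then have "\<exists>a b. {a, b} \<in> edges K4 \<and>
      (d = {\<psi> a, \<psi> b} \<and> g {a, b} \<in> d \<or> 1 \<le> k {a, b} \<and> d = {\<psi> a, g {a, b}})"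
    proof (elim insertE emptyE)
      assume "d = {1, 2}"
      then show ?thesis using e(1,2) sy g(1) \<psi> by (intro exI[of _ s] exI[of _ y]) auto
    next
      assume "d = {1, 5}"
      then show ?thesis using e(1,2) sy g(1) \<psi> by (intro exI[of _ y] exI[of _ s]) (auto simp: insert_commute)
    next
      assume "d = {2, 3}"
      then show ?thesis using inE(1) g(3) \<psi> by (intro exI[of _ s] exI[of _ t]) auto
    next
      assume "d = {4, 3}"
      then show ?thesis using e(3,4) x(2) g(2) \<psi> by (intro exI[of _ t] exI[of _ x]) auto
    next
      assume "d = {5, 4}"
      then show ?thesis using e(3,4) x(2) g(2) xx by (intro exI[of _ x] exI[of _ t]) (auto simp: insert_commute)
    next
      assume "d = {2, 5}"
      then show ?thesis using inE(2) g(4) \<psi> by (intro exI[of _ s] exI[of _ z]) auto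
    next
      assume "d = {3, 5}"
      then show ?thesis using inE(3) x(3) xx \<psi> by (intro exI[of _ t] exI[of _ x']) auto
    qed
    then show "card d = 2 \<and> (\<exists>a b. {a, b} \<in> edges K4 \<and>
      (d = {\<psi> a, \<psi> b} \<and> g {a, b} \<in> d \<or> 1 \<le> k {a, b} \<and> d = {\<psi> a, g {a, b}}))"
      using d simple_graph_F5 by (simp add: simple_graph_def)
  next
    fix a b assume "a \<in> verts K4" "b \<in> verts K4" "\<psi> a = \<psi> b" "a \<noteq> b"
    then have "{a, b} = {y, z}" "\<psi> a = 5" using \<psi> by (auto simp: V)
    then show "{a, b} \<in> edges K4 \<and> g {a, b} = \<psi> a" using inE(4) g(5) by simp
  next
    fix d assume d: "d \<in> edges K4"
    show "g d \<in> \<psi> ` d \<or> g d \<notin> \<psi> ` verts K4 \<and> (\<forall>d'\<in>edges K4. g d' = g d \<longrightarrow> d' = d)"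
    proof (cases "d = e \<or> d = e'")
      case True
      then have "g d \<notin> \<psi> ` verts K4" using g \<psi> by (auto simp: V)
      moreover have "d' = d" if "g d' = g d" for d' using that True g(1,2) by (auto simp: g_def split: if_splits)
      ultimately show ?thesis by blast
    next
      case False
      have "g d \<in> \<psi> ` d"
      proof (cases "s \<in> d")
        case True
        then have "g d = \<psi> s" using False \<psi> by (simp add: g_def)
        then show ?thesis using True by simp
      next
        case s: False
        show ?thesis
        proof (cases "t \<in> d")
          case True
          then have "g d = \<psi> t" using False s \<psi> by (simp add: g_def)
          then show ?thesis using True by simp
        next
          case False
          then have "d = {y, z}" using edge_cases[OF d] s by blast
          then show ?thesis using g(5) \<psi> by simp
        qed
      qed
      then show ?thesis ..
    qed
  qed
qed

section \<open>The fan is not an SPN graph\<close>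

text \<open>
  The matrix with unit diagonal and entries \<open>-1, 1, 0\<close> is the Horn matrix of the cycle
  \<open>1, 2, 5, 3, 4\<close> with its entries at the non-edges \<open>13\<close>, \<open>24\<close>, \<open>14\<close> of the fan replaced by \<open>0\<close>. The
  shift of the diagonal by \<open>1 / 100\<close> gives strict copositivity.
\<close>

definition fan_coeff :: "nat \<Rightarrow> nat \<Rightarrow> real" where
  "fan_coeff h l = (if h = l then 1 + 1 / 100
    else if {h, l} \<in> {{1, 2}, {3, 4}, {2, 5}, {3, 5}} then - 1
    else if {h, l} \<in> {{2, 3}, {1, 5}, {4, 5}} then 1 else 0)"

lemma fan_form:
  "quad_form (verts F5) fan_coeff y =
    (y 1 - y 2)\<^sup>2 + (y 4 - y 3)\<^sup>2 + (y 5)\<^sup>2 + 2 * y 5 * (y 1 - y 2) + 2 * y 5 * (y 4 - y 3) + 2 * y 2 * y 3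
    + ((y 1)\<^sup>2 + (y 2)\<^sup>2 + (y 3)\<^sup>2 + (y 4)\<^sup>2 + (y 5)\<^sup>2) / 100"
proof -
  have "verts F5 = {1, 2, 3, 4, 5}" by (auto simp: F5_def)
  then show ?thesis
    by (simp add: quad_form_def fan_coeff_def doubleton_eq_iff power2_eq_square field_simps)
qed

text \<open>
  The unshifted form equals
  \<open>(y\<^sub>5 - y\<^sub>2 - y\<^sub>3 + y\<^sub>1 + y\<^sub>4)\<^sup>2 + 2 (y\<^sub>2 y\<^sub>4 + y\<^sub>1 y\<^sub>3 - y\<^sub>1 y\<^sub>4)\<close>, which settles the cases
  \<open>y\<^sub>4 \<le> y\<^sub>3\<close> and \<open>y\<^sub>1 \<le> y\<^sub>2\<close>. Otherwise all terms of the expression in \<open>fan_form\<close> are nonnegative.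
\<close>

lemma fan_form_pos:
  assumes nonneg: "\<And>h. h \<in> verts F5 \<Longrightarrow> 0 \<le> y h" and nonzero: "\<exists>h\<in>verts F5. y h \<noteq> 0"
  shows "0 < quad_form (verts F5) fan_coeff y"
proof -
  define q where "q = (y 1 - y 2)\<^sup>2 + (y 4 - y 3)\<^sup>2 + (y 5)\<^sup>2 + 2 * y 5 * (y 1 - y 2)
    + 2 * y 5 * (y 4 - y 3) + 2 * y 2 * y 3"
  have y: "0 \<le> y 1" "0 \<le> y 2" "0 \<le> y 3" "0 \<le> y 4" "0 \<le> y 5" by (auto intro!: nonneg simp: F5_def)
  have square: "q = (y 5 - y 2 - y 3 + y 1 + y 4)\<^sup>2 + 2 * (y 2 * y 4 + y 1 * y 3 - y 1 * y 4)"
    by (simp add: q_def power2_eq_square algebra_simps)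
  have q_nonneg: "0 \<le> q"
  proof -
    consider "y 4 \<le> y 3" | "y 1 \<le> y 2" | "y 3 \<le> y 4" "y 2 \<le> y 1" by linarith
    then show ?thesis
    proof cases
      case 1
      then have "0 \<le> y 1 * (y 3 - y 4)" "0 \<le> y 2 * y 4" using y by auto
      then have "0 \<le> y 2 * y 4 + y 1 * y 3 - y 1 * y 4" by (simp add: algebra_simps)
      then show ?thesis unfolding square by (intro add_nonneg_nonneg) simp_all
    next
      case 2
      then have "0 \<le> y 4 * (y 2 - y 1)" "0 \<le> y 1 * y 3" using y by auto
      then have "0 \<le> y 2 * y 4 + y 1 * y 3 - y 1 * y 4" by (simp add: algebra_simps)
      then show ?thesis unfolding square by (intro add_nonneg_nonneg) simp_all
    next
      case 3
      then show ?thesis using y unfolding q_def by (intro add_nonneg_nonneg mult_nonneg_nonneg) auto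
    qed
  qed
  have norm_pos: "0 < (y 1)\<^sup>2 + (y 2)\<^sup>2 + (y 3)\<^sup>2 + (y 4)\<^sup>2 + (y 5)\<^sup>2"
  proof -
    have "verts F5 = {1, 2, 3, 4, 5}" by (auto simp: F5_def)
    then consider "y 1 \<noteq> 0" | "y 2 \<noteq> 0" | "y 3 \<noteq> 0" | "y 4 \<noteq> 0" | "y 5 \<noteq> 0" using nonzero by auto
    then show ?thesis by cases (simp_all add: add_pos_nonneg add_nonneg_pos)
  qed
  show ?thesis unfolding fan_form q_def[symmetric]
    by (rule add_nonneg_pos[OF q_nonneg divide_pos_pos[OF norm_pos]]) simp
qed

text \<open>
  Read by columns, these are five vectors in \<open>\<real>\<^sup>3\<close>, one for each vertex of the fan, with pairwise
  nonnegative inner products. The only positive products among them are at the edges \<open>12\<close>, \<open>34\<close>,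
  \<open>25\<close>, \<open>35\<close>, where the form has entry \<open>-1\<close>, at \<open>23\<close>, where the loss is small, and at the non-edge
  \<open>14\<close>, where it has entry \<open>0\<close>.
\<close>

definition fan_witness :: "nat \<Rightarrow> nat \<Rightarrow> real" where
  "fan_witness i h = ([[3, 3, -1, 1, 0], [1, -1, 3, 3, 0], [0, 3, 3, 0, 6]] ! i) ! (h - 1)"

theorem spn_graph_no_F5_minor:
  fixes G :: "'n::finite graph"
  assumes G: "simple_graph G" "verts G = UNIV" "spn_graph G"
  shows "\<not> minor_model F5 \<phi> G"
proof
  assume model: "minor_model F5 \<phi> G"
  have V: "verts F5 = {1, 2, 3, 4, 5}" by (auto simp: F5_def)
  have three: "{..<3} = {0, 1, 2 :: nat}" by auto
  have "0 \<le> (\<Sum>i<3. quad_form (verts F5) fan_coeff (fan_witness i))"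
  proof (rule spn_graph_minor_form_sum_nonneg[OF G model])
    show "finite (verts F5)" by (simp add: V)
    show "0 < quad_form (verts F5) fan_coeff y"
      if "\<And>h. h \<in> verts F5 \<Longrightarrow> 0 \<le> y h" "\<exists>h\<in>verts F5. y h \<noteq> 0" for y
      using that by (rule fan_form_pos)
    show "{h, l} \<in> edges F5" if "h \<noteq> l" "fan_coeff h l \<noteq> 0" for h l
    proof -
      have "{h, l} \<in> {{1, 2}, {3, 4}, {2, 5}, {3, 5}} \<or> {h, l} \<in> {{2, 3}, {1, 5}, {4, 5}}"
        using that unfolding fan_coeff_def by metis
      then show ?thesis
        by (elim disjE insertE emptyE) (simp_all add: F5_def insert_commute)
    qed
    show "0 \<le> (\<Sum>i<3. fan_witness i h * fan_witness i l)" if "h \<in> verts F5" "l \<in> verts F5" for h l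
      using that by (auto simp: V three fan_witness_def)
  qed
  then show False by (simp add: three fan_form fan_witness_def)
qed

theorem theorem9p10:
  fixes G :: "'n::finite graph"
  assumes "simple_graph G" and "verts G = UNIV" and "spn_graph G"
  shows "\<not> (\<exists>S. subgraph S G \<and> subdivision F5 S) \<and>
    \<not> (\<exists>S. subgraph S G \<and> subdivision CD6 S) \<and>
    \<not> (\<exists>S k. subgraph S G \<and> subdivision_by K4 k S \<and>
        2 \<le> card {e \<in> edges K4. 1 \<le> k e} \<and> card {e \<in> edges K4. 1 \<le> k e} \<le> 5)"
proof -
  have "\<not> (\<exists>\<phi> :: 'n \<Rightarrow> nat. minor_model F5 \<phi> G)" using spn_graph_no_F5_minor[OF assms] by blast
  then show ?thesis
    using subdivision_F5_minor_model subdivision_CD6_minor_model subdivision_K4_minor_model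
    unfolding subgraph_def by blast
qed

end
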